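(* Let $n\in\mathbb{N}$ and let $\alpha=\frac{2^n}{2(2^n+1)}+\beta$ with $\beta=\sum_{k\geq 0}4^{-2^k}$. Then \[ N D_N^*(z_k(n)) \gg N^{a(n)-\varepsilon} \] for all $\varepsilon>0$, where $a(n)=\log_{2^n}\left(\cot\frac{\pi}{2(2^n+1)}\right)$.
   Context: Perturbed Halton--Kronecker sequence: Fix $n\in\mathbb{N}$ and let $\boldsymbol{c}=(c_0,c_1,\ldots)$ be given by $c_j=1$ if $n\mid j$ and $c_j=0$ otherwise. Let $C$ be the infinite $\{0,1\}$-matrix equal to the identity except that its first row is $\boldsymbol c$. For an integer $k\ge0$ with binary digits $k=k_0+k_12+k_22^2+\cdots$, compute $(y_0,y_1,\ldots)=C(k_0,k_1,\ldots)^{\top}$ modulo $2$ (so $y_0\equiv\sum_j c_jk_j\pmod 2$, $y_i=k_i$ for $i\ge1$) and set $x_k(n)=\sum_{i\ge0}y_i2^{-i-1}$. Put $z_k(n)=(x_k(n),\{k\alpha\})$, $\{t\}$ the fractional part. Star discrepancy of the first $N$ terms of a sequence $(s_k)$ in $[0,1)^2$: $D_N^*=\sup_{(x_1,x_2)\in(0,1]^2}\frac1N\left|\#\{0\le k<N:s_k\in[0,x_1)\times[0,x_2)\}-Nx_1x_2\right|$. Notation: $A(N)\gg B(N)$ means that there is a constant $c>0$ with $|A(N)|\ge c|B(N)|$ for infinitely many $N\in\mathbb{N}$. *)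

theory Defs
  imports "HOL-Analysis.Analysis"
begin

definition binary_digit :: "nat \<Rightarrow> nat \<Rightarrow> nat" where
  "binary_digit k j = k div 2 ^ j mod 2"

definition perturbation_row :: "nat \<Rightarrow> nat \<Rightarrow> nat" where
  "perturbation_row n j = (if n dvd j then 1 else 0)"

text \<open>The infinite identity matrix with its first row (index 0) replaced by \<open>c\<close>.\<close>

definition perturbed_identity :: "(nat \<Rightarrow> nat) \<Rightarrow> nat \<Rightarrow> nat \<Rightarrow> nat" where
  "perturbed_identity c i j = (if i = 0 then c j else if i = j then 1 else 0)"

text \<open>
  The product, modulo 2, of an infinite matrix with the digit vector of \<open>k\<close>. The sum runs over
  the finitely many positions of nonzero digits only, since a sum over an infinite set is 0.
\<close>

definition digit_transform :: "(nat \<Rightarrow> nat \<Rightarrow> nat) \<Rightarrow> nat \<Rightarrow> nat \<Rightarrow> nat" where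
  "digit_transform C k i = (\<Sum>j | binary_digit k j \<noteq> 0. C i j * binary_digit k j) mod 2"

definition digital_sequence :: "(nat \<Rightarrow> nat \<Rightarrow> nat) \<Rightarrow> nat \<Rightarrow> real" where
  "digital_sequence C k = (\<Sum>i. real (digit_transform C k i) / 2 ^ (i + 1))"

definition perturbed_halton_kronecker :: "nat \<Rightarrow> real \<Rightarrow> nat \<Rightarrow> real \<times> real" where
  "perturbed_halton_kronecker n \<alpha> k =
     (digital_sequence (perturbed_identity (perturbation_row n)) k, frac (real k * \<alpha>))"

definition star_discrepancy :: "(nat \<Rightarrow> real \<times> real) \<Rightarrow> nat \<Rightarrow> real" where
  "star_discrepancy s N =
     (SUP (x1, x2) \<in> {0<..1} \<times> {0<..1}.
        1 / real N * \<bar>real (card {k. k < N \<and> s k \<in> {0..<x1} \<times> {0..<x2}}) - real N * x1 * x2\<bar>)"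

text \<open>An \<open>\<Omega>\<close>-type relation: the lower bound is required for infinitely many \<open>N\<close> only.\<close>

definition infinitely_often_gg :: "(nat \<Rightarrow> real) \<Rightarrow> (nat \<Rightarrow> real) \<Rightarrow> bool" where
  "infinitely_often_gg A B \<longleftrightarrow> (\<exists>c>0. infinite {N. \<bar>A N\<bar> \<ge> c * \<bar>B N\<bar>})"

end

theory Submission
  imports Defs "HOL-Real_Asymp.Real_Asymp"
begin

text \<open>
  The first coordinate of the \<open>k\<close>-th point lies in \<open>[0, 1/2)\<close> iff \<open>y\<^sub>0 = 0\<close>. Comparing the boxes
  \<open>[0, 1/2) \<times> [0, x)\<close> and \<open>[0, 1) \<times> [0, x)\<close> and integrating against \<open>e\<^sup>2\<^sup>\<pi>\<^sup>i\<^sup>x\<close> (as for Koksma's inequality)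
  bounds \<open>N D\<^sup>*\<close> below by a constant times the norm of \<open>\<Sum>k<N. (-1)^y\<^sub>0(k) e(k \<alpha>)\<close>, where \<open>e(x)\<close> is
  \<open>cis (2 \<pi> x)\<close>. For \<open>N = 2^(n L)\<close> this sum is the product over \<open>j < n L\<close> of \<open>1 \<plusminus> e(2^j \<alpha>)\<close>, with the
  minus sign iff \<open>n dvd j\<close>.

  For \<open>\<alpha>\<^sub>0 = \<alpha> - \<beta>\<close> in place of \<open>\<alpha>\<close>, a block of \<open>n\<close> factors telescopes to \<open>(1 - z^(2^n)) / (1 + z)\<close>
  with \<open>z = e(\<plusminus>\<alpha>\<^sub>0)\<close> and \<open>z^(2^n) = cnj z\<close>; its norm is \<open>tan (\<pi> \<alpha>\<^sub>0) = cot (\<pi> / (2 (2^n + 1)))\<close>, so the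
  norm of the whole product is exactly \<open>N powr a\<close>. Passing from \<open>\<alpha>\<^sub>0\<close> to \<open>\<alpha>\<close> changes the \<open>j\<close>-th factor by a
  ratio of at least \<open>exp (- C \<delta>\<^sub>j)\<close>, where \<open>\<delta>\<^sub>j\<close> is the fractional part of \<open>2^j \<beta>\<close>. Since
  \<open>\<delta>\<^sub>j\<^sub>+\<^sub>1 = 2 \<delta>\<^sub>j - d\<^sub>j\<^sub>+\<^sub>1\<close> for the binary digits \<open>d\<close> of \<open>\<beta>\<close>, the sum of the \<open>\<delta>\<^sub>j\<close> telescopes to about the
  number of nonzero digits, which is only logarithmic in \<open>n L\<close>. Hence the total loss is \<open>N powr o(1)\<close>.
\<close>

section \<open>Binary digits and the product formula for the signed exponential sum\<close>

lemma binary_digit_eq_0: "k < 2 ^ m \<Longrightarrow> m \<le> j \<Longrightarrow> binary_digit k j = 0"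
proof -
  assume "k < 2 ^ m" "m \<le> j"
  then have "k < 2 ^ j"
    by (meson less_le_trans one_le_numeral power_increasing)
  then show ?thesis by (simp add: binary_digit_def)
qed

lemma binary_digit_add_power:
  assumes "k < 2 ^ m"
  shows "binary_digit (k + 2 ^ m) j = (if j = m then 1 else binary_digit k j)"
proof -
  consider "j < m" | "j = m" | "j > m" by linarith
  then show ?thesis
  proof cases
    case 1
    then obtain d where d: "m = j + Suc d" by (metis less_imp_Suc_add add_Suc_right)
    have "2 ^ m = 2 ^ j * (2 * 2 ^ d :: nat)" by (simp add: d power_add)
    then have "(k + 2 ^ m) div 2 ^ j = k div 2 ^ j + 2 * 2 ^ d"
      by (metis add.commute div_mult_self2 power_eq_0_iff zero_neq_numeral)
    then show ?thesis using 1 by (simp add: binary_digit_def)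
  next
    case 2
    then show ?thesis using assms by (simp add: binary_digit_def)
  next
    case 3
    have "k + 2 ^ m < 2 ^ Suc m" using assms by simp
    moreover have "k < 2 ^ Suc m" using assms by simp
    ultimately show ?thesis using 3 binary_digit_eq_0[of _ "Suc m" j] by simp
  qed
qed

lemma digit_transform_eq_sum:
  assumes "k < 2 ^ m"
  shows "digit_transform C k i = (\<Sum>j<m. C i j * binary_digit k j) mod 2"
proof -
  have "{j. binary_digit k j \<noteq> 0} \<subseteq> {..<m}"
    using binary_digit_eq_0[OF assms] by (metis (mono_tags, lifting) lessThan_iff mem_Collect_eq not_le subsetI)
  then have "(\<Sum>j | binary_digit k j \<noteq> 0. C i j * binary_digit k j) = (\<Sum>j<m. C i j * binary_digit k j)"
    by (intro sum.mono_neutral_left) auto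
  then show ?thesis by (simp add: digit_transform_def)
qed

lemma digit_transform_le_1: "digit_transform C k i \<le> 1"
  by (simp add: digit_transform_def)

lemma digit_transform_perturbed_pos:
  assumes "i > 0"
  shows "digit_transform (perturbed_identity c) k i = binary_digit k i"
proof -
  \<comment> \<open>The cutoff \<open>k + i + 1\<close> covers all digits of k and also the index i,
    so the finite sum contains the diagonal entry.\<close>
  have "i < 2 ^ i" "k < 2 ^ k" by auto
  then have k: "k < 2 ^ (k + i + 1)"
    by (meson less_le_trans le_add1 one_le_numeral power_increasing trans_le_add1)
  have "(\<Sum>j<k+i+1. perturbed_identity c i j * binary_digit k j) =
      (\<Sum>j<k+i+1. if j = i then binary_digit k i else 0)"
    using assms by (intro sum.cong) (auto simp: perturbed_identity_def)
  also have "\<dots> = binary_digit k i" by (subst sum.delta) auto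
  finally show ?thesis
    unfolding digit_transform_eq_sum[OF k] by (simp add: binary_digit_def)
qed

text \<open>The ring is left open because the sign occurs both as a real counting weight and as a
  complex coefficient.\<close>

abbreviation digit_sign :: "(nat \<Rightarrow> nat) \<Rightarrow> nat \<Rightarrow> 'a :: comm_ring_1" where
  "digit_sign c k \<equiv> (-1) ^ digit_transform (perturbed_identity c) k 0"

lemma digit_sign_eq:
  assumes "k < 2 ^ m"
  shows "digit_sign c k = (-1) ^ (\<Sum>j<m. c j * binary_digit k j)"
  unfolding digit_transform_eq_sum[OF assms]
  by (auto simp: perturbed_identity_def minus_one_power_iff even_iff_mod_2_eq_zero)

lemma digit_sign_add_power:
  assumes "k < 2 ^ m"
  shows "(digit_sign c (k + 2 ^ m) :: 'a :: comm_ring_1) = (-1) ^ c m * digit_sign c k"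
proof -
  have sum: "(\<Sum>j<Suc m. c j * binary_digit (k + 2 ^ m) j) = (\<Sum>j<m. c j * binary_digit k j) + c m"
    using assms by (simp add: binary_digit_add_power)
  have "k + 2 ^ m < 2 ^ Suc m" using assms by simp
  then show ?thesis
    by (simp only: digit_sign_eq[of "k + 2 ^ m" "Suc m"] digit_sign_eq[OF assms] sum power_add mult.commute)
qed

text \<open>The sign is multiplicative over binary digits, so splitting off the top digit peels one
  factor from the product.\<close>

lemma sum_digit_sign_power:
  fixes x :: "'a :: comm_ring_1"
  shows "(\<Sum>k<2 ^ m. digit_sign c k * x ^ k) = (\<Prod>j<m. 1 + (-1) ^ c j * x ^ (2 ^ j))"
proof (induction m)
  case 0
  show ?case using digit_sign_eq[of 0 0] by simp
next
  case (Suc m)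
  have "{..<2 ^ Suc m} = {..<2 ^ m} \<union> {2 ^ m..<2 ^ m + 2 ^ m :: nat}" by auto
  then have "(\<Sum>k<2 ^ Suc m. digit_sign c k * x ^ k) =
      (\<Sum>k<2 ^ m. digit_sign c k * x ^ k) + (\<Sum>k=2 ^ m..<2 ^ m + 2 ^ m. digit_sign c k * x ^ k)"
    by (simp add: sum.union_disjoint ivl_disj_int)
  also have "(\<Sum>k=2 ^ m..<2 ^ m + 2 ^ m. digit_sign c k * x ^ k) =
      (\<Sum>k<2 ^ m. digit_sign c (k + 2 ^ m) * x ^ (k + 2 ^ m))"
    using sum.shift_bounds_nat_ivl[of "\<lambda>k. digit_sign c k * x ^ k" 0 "2 ^ m" "2 ^ m"]
    by (simp add: atLeast0LessThan)
  also have "\<dots> = (\<Sum>k<2 ^ m. digit_sign c k * x ^ k) * ((-1) ^ c m * x ^ (2 ^ m))"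
    unfolding sum_distrib_right
    by (intro sum.cong) (auto simp: digit_sign_add_power power_add mult_ac)
  finally show ?case using Suc by (simp add: algebra_simps)
qed

section \<open>From the star discrepancy to exponential sums\<close>

lemma digital_sequence_perturbed_bounds:
  fixes c k
  defines "s \<equiv> digital_sequence (perturbed_identity c) k"
    and "y \<equiv> real (digit_transform (perturbed_identity c) k 0)"
  shows "y / 2 \<le> s" and "s < y / 2 + 1 / 2"
proof -
  let ?y = "\<lambda>i. real (digit_transform (perturbed_identity c) k i) / 2 ^ (i + 1)"
  have k: "k < 2 ^ k" by simp
  have "?y i = 0" if "i \<notin> {..<Suc k}" for i
    using that digit_transform_perturbed_pos[of i c k] binary_digit_eq_0[OF k, of i] by simp
  then have s: "s = (\<Sum>i<Suc k. ?y i)"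
    unfolding s_def digital_sequence_def by (intro suminf_finite) auto
  also have "\<dots> = y / 2 + (\<Sum>i<k. ?y (Suc i))"
    by (subst sum.lessThan_Suc_shift) (simp add: y_def)
  finally have s: "s = y / 2 + (\<Sum>i<k. ?y (Suc i))" .
  show "y / 2 \<le> s" unfolding s by (simp add: sum_nonneg)
  have geometric: "(\<Sum>i<m. 1 / 2 ^ (i + 2)) = 1 / 2 - (1 :: real) / 2 ^ (m + 1)" for m :: nat
    by (induction m) (simp_all add: field_simps)
  have "(\<Sum>i<k. ?y (Suc i)) \<le> (\<Sum>i<k. 1 / 2 ^ (i + 2))"
    using digit_transform_le_1 by (intro sum_mono) (simp add: divide_simps)
  \<comment> \<open>Only finitely many digits are nonzero, so the geometric sum is finite and the
    inequality strict: the first coordinate lies below 1/2 iff y_0 = 0.\<close>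
  also have "\<dots> < 1 / 2" unfolding geometric by simp
  finally show "s < y / 2 + 1 / 2" unfolding s by simp
qed

text \<open>Koksma-type argument with e(t) = cis (2 pi t): write e(t) as 1 minus the integral of e'
  over [t, 1]. Summation gives S(1) minus the integral of S e' over [0, 1], where S is the weighted
  counting function, |S| <= B and |e'| = 2 pi.\<close>

lemma norm_weighted_exponential_sum_le:
  fixes w t :: "nat \<Rightarrow> real"
  assumes t: "\<And>k. k < N \<Longrightarrow> 0 \<le> t k" "\<And>k. k < N \<Longrightarrow> t k < 1"
    and B: "\<And>x. 0 < x \<Longrightarrow> x \<le> 1 \<Longrightarrow> \<bar>\<Sum>k<N. w k * of_bool (t k < x)\<bar> \<le> B"
  shows "norm (\<Sum>k<N. of_real (w k) * cis (2 * pi * t k)) \<le> (1 + 2 * pi) * B"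
proof -
  let ?e = "\<lambda>x. cis (2 * pi * x)"
  let ?e' = "\<lambda>x. 2 * pi * \<i> * ?e x"
  have B0: "0 \<le> B" using B[of 1] by simp
  have deriv: "(?e has_vector_derivative ?e' x) (at x within A)" for x A
  proof -
    have "((\<lambda>z. exp (2 * pi * \<i> * z)) has_field_derivative 2 * pi * \<i> * exp (2 * pi * \<i> * of_real x)) (at (of_real x))"
      by (auto intro!: derivative_eq_intros)
    from has_vector_derivative_real_field[OF this] show ?thesis
      by (simp add: cis_conv_exp mult_ac)
  qed
  have int: "((\<lambda>x. of_real (w k * of_bool (t k < x)) * ?e' x) has_integral of_real (w k) * (1 - ?e (t k))) {0..1}"
    if "k < N" for k
  proof -
    have "(?e' has_integral ?e 1 - ?e (t k)) {t k..1}"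
      using t[OF that] by (intro fundamental_theorem_of_calculus deriv) auto
    then have "((\<lambda>x. if x \<in> {t k..1} then ?e' x else 0) has_integral 1 - ?e (t k)) {0..1}"
      using t[OF that] by (subst has_integral_restrict) auto
    \<comment> \<open>The conditions \<open>t k \<le> x\<close> and \<open>t k < x\<close> differ
      only at the single point x = \<open>t k\<close>.\<close>
    then have "((\<lambda>x. of_real (of_bool (t k < x)) * ?e' x) has_integral 1 - ?e (t k)) {0..1}"
      by (rule has_integral_spike_finite[of "{t k}", rotated 2]) auto
    from has_integral_mult_right[OF this, of "of_real (w k)"] show ?thesis
      by (simp add: mult.assoc)
  qed
  let ?S = "\<lambda>x. \<Sum>k<N. w k * of_bool (t k < x)"
  have "((\<lambda>x. \<Sum>k<N. of_real (w k * of_bool (t k < x)) * ?e' x) has_integral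
      (\<Sum>k<N. of_real (w k) * (1 - ?e (t k)))) {0..1}"
    by (intro has_integral_sum int) auto
  moreover have "(\<Sum>k<N. of_real (w k * of_bool (t k < x)) * ?e' x) = of_real (?S x) * ?e' x" for x
    by (simp only: of_real_sum of_real_mult sum_distrib_right)
  ultimately have I: "((\<lambda>x. of_real (?S x) * ?e' x) has_integral
      (\<Sum>k<N. of_real (w k) * (1 - ?e (t k)))) {0..1}" by simp
  have "norm (of_real (?S x) * ?e' x) \<le> 2 * pi * B" if x: "x \<in> {0..1}" for x
  proof -
    have "\<bar>?S x\<bar> \<le> B"
    \<comment> \<open>The bound B is given for x > 0 only; at 0 the sum vanishes because all
      \<open>t k\<close> are nonnegative.\<close>
    proof (cases "x = 0")
      case True
      then have "?S x = 0" using t by (intro sum.neutral) (auto simp: not_less)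
      then show ?thesis using B0 by simp
    next
      case False
      then show ?thesis using x B[of x] by simp
    qed
    then show ?thesis
      by (simp add: norm_mult mult_ac del: of_real_sum)
  qed
  then have "norm (\<Sum>k<N. of_real (w k) * (1 - ?e (t k))) \<le> 2 * pi * B"
    using has_integral_bound[OF _ I[unfolded box_real(2)[symmetric]], of "2 * pi * B"] B0 by simp
  moreover have "(\<Sum>k<N. of_real (w k) * ?e (t k)) =
      of_real (?S 1) - (\<Sum>k<N. of_real (w k) * (1 - ?e (t k)))"
  proof -
    have "?S 1 = (\<Sum>k<N. w k)" using t by (intro sum.cong) auto
    then show ?thesis by (simp add: algebra_simps sum_subtractf)
  qed
  moreover have "norm (of_real (?S 1) :: complex) \<le> B" using B[of 1] by (simp del: of_real_sum)
  ultimately have "norm (\<Sum>k<N. of_real (w k) * ?e (t k)) \<le> B + 2 * pi * B"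
    using norm_triangle_ineq4 by (smt (verit))
  then show ?thesis by (simp add: algebra_simps)
qed

text \<open>A real supremum bounds its members only if the set is bounded above. Here 1 is a bound,
  since the count and \<open>real N * x * y\<close> both lie between 0 and N.\<close>

lemma star_discrepancy_upper:
  assumes "N > 0" "x \<in> {0<..1}" "y \<in> {0<..1}"
  shows "\<bar>real (card {k. k < N \<and> s k \<in> {0..<x} \<times> {0..<y}}) - real N * x * y\<bar>
    \<le> real N * star_discrepancy s N"
proof -
  let ?d = "\<lambda>(x, y). 1 / real N * \<bar>real (card {k. k < N \<and> s k \<in> {0..<x} \<times> {0..<y}}) - real N * x * y\<bar>"
  have "bdd_above (?d ` ({0<..1} \<times> {0<..1}))"
  proof (rule bdd_aboveI2)
    fix p :: "real \<times> real" assume "p \<in> {0<..1} \<times> {0<..1}"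
    then obtain x y where p: "p = (x, y)" "0 < x" "x \<le> 1" "0 < y" "y \<le> 1" by auto
    have "card {k. k < N \<and> s k \<in> {0..<x} \<times> {0..<y}} \<le> card {..<N}" by (rule card_mono) auto
    moreover have "0 \<le> x * y" "x * y \<le> 1" using p by (auto simp: mult_le_one)
    then have "0 \<le> real N * x * y" "real N * x * y \<le> real N"
      by (auto simp: mult.assoc intro: mult_left_le)
    ultimately have "\<bar>real (card {k. k < N \<and> s k \<in> {0..<x} \<times> {0..<y}}) - real N * x * y\<bar> \<le> real N"
      by (simp only: card_lessThan abs_le_iff) linarith
    then show "?d p \<le> 1" using assms(1) by (simp add: p)
  qed
  then have "?d (x, y) \<le> star_discrepancy s N"
    unfolding star_discrepancy_def by (rule cSUP_upper[rotated]) (use assms in auto)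
  then show ?thesis using assms(1) by (simp add: field_simps)
qed

lemma norm_sign_exponential_sum_le:
  assumes "N > 0"
  shows "norm (\<Sum>k<N. digit_sign (perturbation_row n) k * cis (2 * pi * \<alpha>) ^ k)
    \<le> 3 * (1 + 2 * pi) * (real N * star_discrepancy (perturbed_halton_kronecker n \<alpha>) N)"
proof -
  let ?c = "perturbation_row n" and ?z = "perturbed_halton_kronecker n \<alpha>"
  let ?y = "\<lambda>k. digit_transform (perturbed_identity ?c) k 0" and ?t = "\<lambda>k. frac (real k * \<alpha>)"
  define D where "D = real N * star_discrepancy ?z N"
  have fst: "?z k \<in> {0..<1} \<times> {0..<x} \<longleftrightarrow> ?t k < x"
    "?z k \<in> {0..<1/2} \<times> {0..<x} \<longleftrightarrow> ?y k = 0 \<and> ?t k < x" for k x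
    using digital_sequence_perturbed_bounds[of ?c k] digit_transform_le_1[of "perturbed_identity ?c" k 0]
    by (auto simp: perturbed_halton_kronecker_def frac_ge_0 le_Suc_eq)
  have "\<bar>\<Sum>k<N. digit_sign ?c k * of_bool (?t k < x)\<bar> \<le> 3 * D" if x: "0 < x" "x \<le> 1" for x
  proof -
    let ?A = "{k. k < N \<and> ?t k < x}" and ?B = "{k. k < N \<and> ?y k = 0 \<and> ?t k < x}"
    have sign: "digit_sign ?c k = 2 * of_bool (?y k = 0) - (1 :: real)" for k
      using digit_transform_le_1[of "perturbed_identity ?c" k 0] by (auto simp: le_Suc_eq)
    have "(\<Sum>k<N. digit_sign ?c k * of_bool (?t k < x)) =
        2 * (\<Sum>k<N. of_bool (?y k = 0 \<and> ?t k < x)) - (\<Sum>k<N. of_bool (?t k < x) :: real)"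
      unfolding sum_distrib_left sum_subtractf[symmetric] sign
      by (intro sum.cong) (auto)
    also have "(\<Sum>k<N. of_bool (?t k < x) :: real) = card ?A"
      by (simp add: sum.If_cases Int_def of_bool_def)
    also have "(\<Sum>k<N. of_bool (?y k = 0 \<and> ?t k < x) :: real) = card ?B"
      by (simp add: sum.If_cases Int_def of_bool_def)
    finally have S: "(\<Sum>k<N. digit_sign ?c k * of_bool (?t k < x)) = 2 * real (card ?B) - real (card ?A)" .
    have "\<bar>real (card ?A) - real N * 1 * x\<bar> \<le> D"
      using star_discrepancy_upper[OF assms, of 1 x ?z] x unfolding fst D_def by simp
    moreover have "\<bar>real (card ?B) - real N * (1 / 2) * x\<bar> \<le> D"
      using star_discrepancy_upper[OF assms, of "1 / 2" x ?z] x unfolding fst D_def by simp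
    \<comment> \<open>The main terms 2 (N x / 2) and N x cancel, leaving an error of at most 2 D +
      D.\<close>
    ultimately show ?thesis unfolding S by (simp add: abs_if split: if_splits)
  qed
  from norm_weighted_exponential_sum_le[OF frac_ge_0 frac_lt_1 this]
  have "norm (\<Sum>k<N. of_real (digit_sign ?c k) * cis (2 * pi * ?t k)) \<le> (1 + 2 * pi) * (3 * D)"
    by blast
  moreover have "cis (2 * pi * ?t k) = cis (2 * pi * \<alpha>) ^ k" for k
  proof -
    have "cis (2 * pi * ?t k) = cis (2 * pi * (real k * \<alpha>)) / cis (2 * pi * of_int \<lfloor>real k * \<alpha>\<rfloor>)"
      by (simp add: frac_def cis_divide algebra_simps)
    also have "cis (2 * pi * of_int \<lfloor>real k * \<alpha>\<rfloor>) = 1" by (rule cis_multiple_2pi) simp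
    finally show ?thesis by (simp add: Complex.DeMoivre mult_ac)
  qed
  ultimately show ?thesis by (simp add: D_def algebra_simps)
qed

section \<open>The product for the unperturbed angle and its orbit under squaring\<close>

lemma prod_one_plus_power2:
  fixes z :: "'a :: comm_ring_1"
  shows "(1 - z) * (\<Prod>i<n. 1 + z ^ (2 ^ i)) = 1 - z ^ (2 ^ n)"
proof (induction n)
  case (Suc n)
  have "(1 - z) * (\<Prod>i<Suc n. 1 + z ^ (2 ^ i)) = (1 - z ^ (2 ^ n)) * (1 + z ^ (2 ^ n))"
    using Suc by (simp flip: mult.assoc)
  also have "\<dots> = 1 - z ^ (2 ^ n) * z ^ (2 ^ n)" by (simp add: algebra_simps)
  finally show ?case by (simp add: power_add mult_2 flip: power_add)
qed simp

text \<open>Among the indices below n only 0 is divisible by n, so the factor 1 + z of the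
  telescoping product is replaced by 1 - z. Multiplying by 1 + z restores the full telescoping
  product.\<close>

lemma prod_perturbation_block:
  fixes z :: "'a :: comm_ring_1"
  assumes "n \<ge> 1"
  shows "(1 + z) * (\<Prod>i<n. 1 + (-1) ^ perturbation_row n i * z ^ (2 ^ i)) = 1 - z ^ (2 ^ n)"
proof -
  obtain m where m: "n = Suc m" using assms by (cases n) auto
  have "\<not> n dvd Suc i" if "i < m" for i using that m by (auto dest: dvd_imp_le)
  then have "(\<Prod>i<m. 1 + (-1) ^ perturbation_row n (Suc i) * z ^ (2 ^ Suc i)) = (\<Prod>i<m. 1 + z ^ (2 ^ Suc i))"
    by (intro prod.cong) (auto simp: perturbation_row_def)
  then show ?thesis
    unfolding prod_one_plus_power2[symmetric] m prod.lessThan_Suc_shift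
    unfolding m[symmetric] by (simp add: perturbation_row_def mult_ac)
qed

definition base_angle :: "nat \<Rightarrow> real" where
  "base_angle n = 2 ^ n / (2 * (2 ^ n + 1))"

abbreviation base_root :: "nat \<Rightarrow> complex" where
  "base_root n \<equiv> cis (2 * pi * base_angle n)"

text \<open>\<open>(2 ^ n + 1) * base_angle n\<close> equals 2^(n-1), an integer as n >= 1, so the
  (2^n + 1)-st power of the root is 1.\<close>

lemma base_root_power:
  assumes "n \<ge> 1"
  shows "base_root n ^ (2 ^ n) = cnj (base_root n)"
proof -
  obtain m where m: "n = Suc m" using assms by (cases n) auto
  define q :: real where "q = 2 ^ n"
  have q: "q > 0" by (simp add: q_def)
  have "(2 ^ n + 1) * base_angle n = 2 ^ n / 2"
    unfolding base_angle_def q_def[symmetric] using q by (simp add: field_simps)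
  then have "2 ^ n * base_angle n = of_int (2 ^ m) - base_angle n"
    by (simp add: m algebra_simps)
  moreover have "base_root n ^ (2 ^ n) = cis (2 * pi * (2 ^ n * base_angle n))"
    by (simp add: Complex.DeMoivre mult_ac)
  ultimately have "base_root n ^ (2 ^ n) = cis (2 * pi * (of_int (2 ^ m) - base_angle n))"
    by simp
  also have "\<dots> = cis (2 * pi * of_int (2 ^ m)) / base_root n"
    by (simp only: cis_divide right_diff_distrib)
  also have "cis (2 * pi * of_int (2 ^ m)) = 1" by (rule cis_multiple_2pi) simp
  finally show ?thesis by (simp add: cis_cnj divide_inverse)
qed

lemma base_root_power_block:
  assumes "n \<ge> 1"
  shows "base_root n ^ (2 ^ (n * m)) = (if even m then base_root n else cnj (base_root n))"
proof (induction m)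
  case (Suc m)
  have "base_root n ^ (2 ^ (n * Suc m)) = (base_root n ^ (2 ^ (n * m))) ^ (2 ^ n)"
    by (simp add: power_add mult.commute flip: power_mult)
  then show ?case
    using Suc base_root_power[OF assms] by (auto simp flip: complex_cnj_power)
qed simp

lemma base_angle_bounds: "0 < base_angle n" "base_angle n < 1 / 2"
  by (auto simp: base_angle_def field_simps add_pos_pos)

lemma norm_one_minus_cis: "norm (1 - cis t) = 2 * \<bar>sin (t / 2)\<bar>"
proof -
  have "(norm (1 - cis t))\<^sup>2 = (1 - cos t)\<^sup>2 + (sin t)\<^sup>2"
    by (simp add: cmod_power2)
  also have "\<dots> = 2 - 2 * cos t"
    using sin_cos_squared_add[of t] by (simp add: power2_eq_square algebra_simps)
  also have "\<dots> = (2 * \<bar>sin (t / 2)\<bar>)\<^sup>2"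
    using cos_double_sin[of "t / 2"] by (simp add: power_mult_distrib)
  finally show ?thesis by (rule power2_eq_imp_eq) auto
qed

lemma norm_one_plus_cis: "norm (1 + cis t) = 2 * \<bar>cos (t / 2)\<bar>"
proof -
  have "(norm (1 + cis t))\<^sup>2 = (1 + cos t)\<^sup>2 + (sin t)\<^sup>2"
    by (simp add: cmod_power2)
  also have "\<dots> = 2 + 2 * cos t"
    using sin_cos_squared_add[of t] by (simp add: power2_eq_square algebra_simps)
  also have "\<dots> = (2 * \<bar>cos (t / 2)\<bar>)\<^sup>2"
    using cos_double_cos[of "t / 2"] by (simp add: power_mult_distrib)
  finally show ?thesis by (rule power2_eq_imp_eq) auto
qed

text \<open>By the half-angle formulas the ratio of the norms is the tangent of
  \<open>pi * base_angle n\<close>, and this angle is complementary to pi / (2 (2^n + 1)).\<close>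

lemma norm_base_root: "norm (1 - base_root n) > 0" "norm (1 + base_root n) > 0"
  "norm (1 - base_root n) = cot (pi / (2 * (2 ^ n + 1))) * norm (1 + base_root n)"
proof -
  define t where "t = pi * base_angle n"
  have t: "0 < t" "t < pi / 2"
    using base_angle_bounds[of n] by (auto simp: t_def field_simps)
  then have sc: "sin t > 0" "cos t > 0" by (auto intro: sin_gt_zero2 cos_gt_zero)
  have *: "norm (1 - base_root n) = 2 * sin t" "norm (1 + base_root n) = 2 * cos t"
    using sc unfolding norm_one_minus_cis norm_one_plus_cis by (simp_all add: t_def)
  define q :: real where "q = 2 ^ n"
  have q: "q > 0" by (simp add: q_def)
  have "pi / (2 * (2 ^ n + 1)) = pi / 2 - t"
    unfolding t_def base_angle_def q_def[symmetric] using q by (simp add: field_simps)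
  then have "cot (pi / (2 * (2 ^ n + 1))) = sin t / cos t"
    by (simp add: cot_def cos_diff sin_diff)
  then show "norm (1 - base_root n) > 0" "norm (1 + base_root n) > 0"
    "norm (1 - base_root n) = cot (pi / (2 * (2 ^ n + 1))) * norm (1 + base_root n)"
    using sc unfolding * by simp_all
qed

lemma norm_prod_base_root:
  assumes "n \<ge> 1"
  shows "norm (\<Prod>j<n * L. 1 + (-1) ^ perturbation_row n j * base_root n ^ (2 ^ j)) =
    cot (pi / (2 * (2 ^ n + 1))) ^ L"
proof (induction L)
  case (Suc L)
  let ?f = "\<lambda>j. 1 + (-1) ^ perturbation_row n j * base_root n ^ (2 ^ j)"
  define z where "z = base_root n ^ (2 ^ (n * L))"
  have z: "z = base_root n \<or> z = cnj (base_root n)"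
    using base_root_power_block[OF assms, of L] by (auto simp: z_def)
  have norms: "norm (1 + z) = norm (1 + base_root n)" "norm (1 - z ^ (2 ^ n)) = norm (1 - base_root n)"
    using z base_root_power[OF assms] complex_mod_cnj[of "1 + base_root n"] complex_mod_cnj[of "1 - base_root n"]
    by (auto simp flip: complex_cnj_power)
  have "(\<Prod>j<n * Suc L. ?f j) = (\<Prod>j<n * L. ?f j) * (\<Prod>j=n*L..<n*L+n. ?f j)"
    by (subst prod.union_disjoint [symmetric]) (auto simp: ivl_disj_un add.commute intro!: prod.cong)
  also have "(\<Prod>j=n*L..<n*L+n. ?f j) = (\<Prod>i<n. ?f (i + n * L))"
    using prod.shift_bounds_nat_ivl[of ?f 0 "n * L" n] by (simp add: atLeast0LessThan add.commute)
  also have "\<dots> = (\<Prod>i<n. 1 + (-1) ^ perturbation_row n i * z ^ (2 ^ i))"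
    by (intro prod.cong) (auto simp: z_def perturbation_row_def power_add mult.commute simp flip: power_mult)
  \<comment> \<open>Multiplying by \<open>norm (1 + z)\<close> makes the block identity applicable
    without division; the factor is positive and cancels at the end.\<close>
  finally have "norm (\<Prod>j<n * Suc L. ?f j) * norm (1 + z) =
      cot (pi / (2 * (2 ^ n + 1))) ^ L * norm ((1 + z) * (\<Prod>i<n. 1 + (-1) ^ perturbation_row n i * z ^ (2 ^ i)))"
    using Suc by (simp add: norm_mult)
  also have "\<dots> = cot (pi / (2 * (2 ^ n + 1))) ^ Suc L * norm (1 + z)"
    unfolding prod_perturbation_block[OF assms] norms norm_base_root(3) by simp
  finally show ?case using norm_base_root(2)[of n] norms(1) by simp
qed simp

text \<open>Squaring at most doubles the distance to 1. The bound is used backwards: a point that is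
  away from 1 after m squarings was not too close to 1 before.\<close>

lemma norm_one_minus_power2_le:
  fixes z :: "'a :: real_normed_field"
  assumes "norm z \<le> 1"
  shows "norm (1 - z ^ (2 ^ m)) \<le> 2 ^ m * norm (1 - z)"
  using norm_power_diff[of 1 z "2 ^ m"] assms by simp

lemma norm_one_minus_base_root_power_ge:
  assumes "n \<ge> 1"
  shows "norm (1 - base_root n) / 2 ^ n \<le> norm (1 - base_root n ^ (2 ^ j))"
proof -
  \<comment> \<open>The number of squarings up to the next multiple of n beyond j, where the orbit
    is at the root or its conjugate.\<close>
  define r where "r = n * Suc (j div n) - j"
  have "n * (j div n) + j mod n = j" "j mod n < n" using assms by simp_all
  then have r: "n * Suc (j div n) = j + r" "r \<le> n"
    unfolding r_def mult_Suc_right by linarith+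
  have "norm (1 - base_root n) = norm (1 - base_root n ^ (2 ^ (j + r)))"
    unfolding r(1)[symmetric] base_root_power_block[OF assms]
    using complex_mod_cnj[of "1 - base_root n"] by simp
  also have "\<dots> \<le> 2 ^ r * norm (1 - base_root n ^ (2 ^ j))"
    using norm_one_minus_power2_le[of "base_root n ^ (2 ^ j)" r] by (simp add: norm_power power_add power_mult)
  also have "\<dots> \<le> 2 ^ n * norm (1 - base_root n ^ (2 ^ j))"
    using r(2) by (intro mult_right_mono power_increasing) auto
  finally show ?thesis by (simp add: field_simps)
qed

section \<open>The binary expansion of beta\<close>

text \<open>The binary digits of \<open>\<beta>\<close>: position \<open>p\<close> carries a 1 precisely if \<open>p \<in> {2, 4, 8, \<dots>}\<close>.\<close>

definition sparse_digit :: "nat \<Rightarrow> real" where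
  "sparse_digit p = of_bool (\<exists>i. p = 2 ^ Suc i)"

text \<open>This is the fractional part of 2^j beta; the series form yields the doubling recursion
  directly.\<close>

definition sparse_tail :: "nat \<Rightarrow> real" where
  "sparse_tail j = (\<Sum>p. sparse_digit (j + Suc p) / 2 ^ Suc p)"

lemma sparse_digit_bounds: "0 \<le> sparse_digit p" "sparse_digit p \<le> 1"
  by (simp_all add: sparse_digit_def)

lemma power_half_Suc_sums: "(\<lambda>p. 1 / 2 ^ Suc p :: real) sums 1"
  using power_half_series by (simp add: power_one_over)

lemma summable_sparse_tail: "summable (\<lambda>p. sparse_digit (j + Suc p) / 2 ^ Suc p)"
  by (rule summable_comparison_test'[OF sums_summable[OF power_half_Suc_sums], of 0])
    (simp add: sparse_digit_bounds divide_right_mono)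

lemma sparse_tail_bounds: "0 \<le> sparse_tail j" "sparse_tail j \<le> 1"
proof -
  show "0 \<le> sparse_tail j"
    unfolding sparse_tail_def by (intro suminf_nonneg summable_sparse_tail) (simp add: sparse_digit_bounds)
  have "sparse_tail j \<le> (\<Sum>p. 1 / 2 ^ Suc p)"
    unfolding sparse_tail_def
    by (intro suminf_le summable_sparse_tail sums_summable[OF power_half_Suc_sums] divide_right_mono)
      (simp_all add: sparse_digit_bounds)
  then show "sparse_tail j \<le> 1" using sums_unique[OF power_half_Suc_sums] by simp
qed

lemma sparse_tail_Suc: "sparse_tail (Suc j) = 2 * sparse_tail j - sparse_digit (Suc j)"
proof -
  have "sparse_tail j = sparse_digit (Suc j) / 2 + (\<Sum>p. sparse_digit (j + Suc (Suc p)) / 2 ^ Suc (Suc p))"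
    unfolding sparse_tail_def using suminf_split_head[OF summable_sparse_tail[of j]] by simp
  also have "(\<Sum>p. sparse_digit (j + Suc (Suc p)) / 2 ^ Suc (Suc p)) =
      (\<Sum>p. 1 / 2 * (sparse_digit (Suc j + Suc p) / 2 ^ Suc p))"
    by simp
  also have "\<dots> = 1 / 2 * sparse_tail (Suc j)"
    unfolding sparse_tail_def by (rule suminf_mult[OF summable_sparse_tail])
  finally show ?thesis by simp
qed

lemma sparse_tail_0: "sparse_tail 0 = (\<Sum>k. 1 / 4 ^ (2 ^ k))"
proof -
  \<comment> \<open>As 4^(2^k) = 2^(2^(k+1)), the nonzero digits sit at the positions 2^(k+1); the
    shift by 1 arises because the series index p belongs to position \<open>Suc p\<close>.\<close>
  let ?g = "\<lambda>k::nat. 2 ^ Suc k - 1 :: nat"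
  have "strict_mono ?g"
    by (rule strict_monoI) (simp add: diff_less_mono)
  moreover have "sparse_digit (Suc p) / 2 ^ Suc p = 0" if "p \<notin> range ?g" for p
    using that by (auto simp: sparse_digit_def image_iff) (metis diff_Suc_1 One_nat_def)
  ultimately have "(\<Sum>k. sparse_digit (Suc (?g k)) / 2 ^ Suc (?g k)) = (\<Sum>p. sparse_digit (Suc p) / 2 ^ Suc p)"
    by (rule suminf_mono_reindex)
  moreover have "sparse_digit (Suc (?g k)) / 2 ^ Suc (?g k) = 1 / 4 ^ (2 ^ k)" for k
  proof -
    have "Suc (?g k) = 2 ^ Suc k" by simp
    moreover have "(4 :: real) ^ (2 ^ k) = 2 ^ (2 ^ Suc k)"
      by (simp add: power_mult)
    ultimately show ?thesis unfolding sparse_digit_def by (metis (full_types) of_bool_eq(2))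
  qed
  ultimately show ?thesis by (simp add: sparse_tail_def)
qed

lemma cis_sparse_tail: "cis (2 * pi * sparse_tail j) = cis (2 * pi * sparse_tail 0) ^ (2 ^ j)"
proof (induction j)
  case (Suc j)
  have "cis (2 * pi * sparse_tail (Suc j)) = cis (2 * pi * sparse_tail j) ^ 2 / cis (2 * pi * sparse_digit (Suc j))"
    unfolding sparse_tail_Suc Complex.DeMoivre cis_divide by (simp add: algebra_simps)
  also have "cis (2 * pi * sparse_digit (Suc j)) = 1"
    by (rule cis_multiple_2pi) (simp add: sparse_digit_def)
  finally show ?case using Suc by (simp add: mult.commute flip: power_mult)
qed simp

text \<open>Writing delta for the tails and d for the digits, the recursion reads delta_j =
  (delta_(j+1) - delta_j) + d_(j+1), and the bracket telescopes.\<close>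

lemma sum_sparse_tail: "(\<Sum>j<J. sparse_tail j) \<le> 1 + (\<Sum>j<J. sparse_digit (Suc j))"
proof -
  have "(\<Sum>j<J. sparse_tail j) = sparse_tail J - sparse_tail 0 + (\<Sum>j<J. sparse_digit (Suc j))"
    by (induction J) (simp_all add: sparse_tail_Suc)
  then show ?thesis using sparse_tail_bounds[of J] sparse_tail_bounds[of 0] by simp
qed

lemma sum_sparse_digit_le: "(\<Sum>j<2 ^ m. sparse_digit (Suc j)) \<le> real m"
proof -
  have "{j. j < 2 ^ m \<and> (\<exists>i. Suc j = 2 ^ Suc i)} \<subseteq> (\<lambda>i. 2 ^ Suc i - 1) ` {..<m}"
  proof safe
    fix j i assume "j < 2 ^ m" "Suc j = 2 ^ Suc i"
    then have "(2 :: nat) ^ Suc i \<le> 2 ^ m" by simp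
    then have "i < m" by (subst (asm) power_increasing_iff) auto
    then show "j \<in> (\<lambda>i. 2 ^ Suc i - 1) ` {..<m}"
      using \<open>Suc j = 2 ^ Suc i\<close> by (metis diff_Suc_1 imageI lessThan_iff)
  qed
  then have "card {j. j < 2 ^ m \<and> (\<exists>i. Suc j = 2 ^ Suc i)} \<le> card {..<m}"
    by (rule surj_card_le[rotated]) simp
  moreover have "(\<Sum>j<2 ^ m. sparse_digit (Suc j)) = real (card {j. j < 2 ^ m \<and> (\<exists>i. Suc j = 2 ^ Suc i)})"
    by (simp add: sparse_digit_def of_bool_def sum.If_cases Int_def)
  ultimately show ?thesis by simp
qed

lemma sparse_tail_add:
  assumes "\<And>p. j < p \<Longrightarrow> p \<le> j + d \<Longrightarrow> sparse_digit p = 0"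
  shows "sparse_tail (j + d) = 2 ^ d * sparse_tail j"
  using assms
proof (induction d)
  case (Suc d)
  then show ?case by (simp add: sparse_tail_Suc)
qed simp

text \<open>A run of d zero digits after position j forces the tail at j to be at most 2^(-d). Such
  a run starts within a window whose length is independent of A.\<close>

lemma ex_small_sparse_tail:
  obtains j where "A \<le> j" "j \<le> A + d + 2 ^ d" "sparse_tail j \<le> 1 / 2 ^ d"
proof -
  have small: "sparse_tail j \<le> 1 / 2 ^ d" if "\<And>p. j < p \<Longrightarrow> p \<le> j + d \<Longrightarrow> sparse_digit p = 0" for j
    using sparse_tail_add[of j d, OF that] sparse_tail_bounds[of "j + d"] by (simp add: field_simps)
  show thesis
  proof (cases "\<forall>p. A < p \<and> p \<le> A + d \<longrightarrow> sparse_digit p = 0")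
    case True
    then show ?thesis using small[of A] that[of A] by auto
  next
    case False
    then obtain i where i: "A < 2 ^ i" "2 ^ i \<le> A + d"
      by (auto simp: sparse_digit_def simp del: power_Suc)
    \<comment> \<open>Since 2^i' > d, the next power of two exceeds 2^i' + d, so d zeros follow
      position 2^i'. This position stays in the window because it is either 2^i <= A + d or
      2^d.\<close>
    define i' where "i' = max i d"
    have "sparse_digit p = 0" if p: "2 ^ i' < p" "p \<le> 2 ^ i' + d" for p
    proof (rule ccontr)
      assume "sparse_digit p \<noteq> 0"
      then obtain l where l: "p = 2 ^ Suc l" by (auto simp: sparse_digit_def)
      then have "i' < Suc l" using p(1) by (simp only: l power_strict_increasing_iff)
      then have "(2 :: nat) ^ Suc i' \<le> p" unfolding l by (intro power_increasing) auto
      moreover have "d < 2 ^ i'" by (metis i'_def less_exp less_le_trans max.cobounded2 one_le_numeral power_increasing)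
      ultimately show False using p(2) by simp
    qed
    moreover have "(2 :: nat) ^ i' = max (2 ^ i) (2 ^ d)" by (auto simp: i'_def max_def)
    ultimately show ?thesis using i small[of "2 ^ i'"] less_exp[of d] by (intro that[of "2 ^ i'"]) auto
  qed
qed

section \<open>The perturbed orbit stays away from 1\<close>

lemma norm_one_minus_cis_le: "norm (1 - cis t) \<le> \<bar>t\<bar>"
  using abs_sin_x_le_abs_x[of "t / 2"] by (simp add: norm_one_minus_cis)

abbreviation perturbed_root :: "nat \<Rightarrow> complex" where
  "perturbed_root n \<equiv> cis (2 * pi * (base_angle n + sparse_tail 0))"

text \<open>The two orbits differ by a rotation through 2 pi times the fractional part of 2^j beta,
  and a chord is at most as long as its arc.\<close>

lemma norm_perturbed_root_diff:
  "norm (base_root n ^ (2 ^ j) - perturbed_root n ^ (2 ^ j)) \<le> 2 * pi * sparse_tail j"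
proof -
  have "perturbed_root n ^ (2 ^ j) = base_root n ^ (2 ^ j) * cis (2 * pi * sparse_tail j)"
    unfolding cis_sparse_tail[of j] power_mult_distrib[symmetric] cis_mult by (simp add: distrib_left)
  then have "base_root n ^ (2 ^ j) - perturbed_root n ^ (2 ^ j) =
      base_root n ^ (2 ^ j) * (1 - cis (2 * pi * sparse_tail j))"
    by (simp add: right_diff_distrib)
  then show ?thesis
    using norm_one_minus_cis_le[of "2 * pi * sparse_tail j"] sparse_tail_bounds(1)[of j]
    by (simp add: norm_mult norm_power)
qed

text \<open>
  If \<open>perturbed_root n ^ (2 ^ j)\<close> were very close to 1, it would remain close to 1 under many
  squarings, but within a bounded number of steps \<open>ex_small_sparse_tail\<close> makes it follow the
  unperturbed orbit, which stays away from 1.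
\<close>

lemma norm_one_minus_perturbed_root_power_ge:
  assumes "n \<ge> 1"
  obtains c where "c > 0" "\<And>j. c \<le> norm (1 - perturbed_root n ^ (2 ^ j))"
proof -
  define b where "b = norm (1 - base_root n) / 2 ^ n"
  have b: "b > 0" using norm_base_root(1)[of n] by (simp add: b_def)
  have "0 < b / (4 * pi)" using b by simp
  \<comment> \<open>This d makes 2 pi 2^(-d) smaller than b / 2, half of the distance that the
    unperturbed orbit keeps from 1.\<close>
  then obtain d where d: "(1 / 2) ^ d < b / (4 * pi)"
    using real_arch_pow_inv[of "b / (4 * pi)" "1 / 2"] by auto
  \<comment> \<open>At most d + 2^d squarings lead from j to an index with small tail, and each
    costs a factor 2.\<close>
  have "b / 2 / 2 ^ (d + 2 ^ d) \<le> norm (1 - perturbed_root n ^ (2 ^ j))" for j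
  proof -
    obtain i where i: "j \<le> i" "i \<le> j + d + 2 ^ d" "sparse_tail i \<le> 1 / 2 ^ d"
      using ex_small_sparse_tail by blast
    define r where "r = i - j"
    have r: "i = j + r" "r \<le> d + 2 ^ d" using i by (auto simp: r_def)
    have "2 * pi * sparse_tail i \<le> 2 * pi * (b / (4 * pi))"
      using i(3) d by (intro mult_left_mono) (auto simp: power_one_over)
    then have "norm (base_root n ^ (2 ^ i) - perturbed_root n ^ (2 ^ i)) \<le> b / 2"
      using norm_perturbed_root_diff[of n i] by (simp add: field_simps)
    moreover have "b \<le> norm (1 - base_root n ^ (2 ^ i))"
      using norm_one_minus_base_root_power_ge[OF assms] by (simp add: b_def)
    moreover have "norm (1 - base_root n ^ (2 ^ i)) \<le> norm (1 - perturbed_root n ^ (2 ^ i)) +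
        norm (base_root n ^ (2 ^ i) - perturbed_root n ^ (2 ^ i))"
      using norm_triangle_ineq4[of "1 - perturbed_root n ^ (2 ^ i)" "base_root n ^ (2 ^ i) - perturbed_root n ^ (2 ^ i)"]
      by simp
    ultimately have "b / 2 \<le> norm (1 - (perturbed_root n ^ (2 ^ j)) ^ (2 ^ r))"
      by (simp add: r(1) power_add power_mult)
    also have "\<dots> \<le> 2 ^ r * norm (1 - perturbed_root n ^ (2 ^ j))"
      by (rule norm_one_minus_power2_le) (simp add: norm_power)
    also have "\<dots> \<le> 2 ^ (d + 2 ^ d) * norm (1 - perturbed_root n ^ (2 ^ j))"
      using r(2) by (intro mult_right_mono power_increasing) auto
    finally show ?thesis by (simp add: field_simps)
  qed
  then show thesis using b by (intro that[of "b / 2 / 2 ^ (d + 2 ^ d)"]) simp_all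
qed

section \<open>Factorwise comparison of the two products\<close>

lemma norm_one_minus_square_le:
  fixes z :: "'a :: real_normed_field"
  assumes "norm z \<le> 1"
  shows "norm (1 - z\<^sup>2) / 2 \<le> norm (1 + (-1) ^ e * z)"
proof -
  let ?y = "(-1) ^ e * z"
  have "norm ?y \<le> 1" using assms by (simp add: norm_mult norm_power)
  \<comment> \<open>The factor with the opposite sign has norm at most 2, so for either sign the
    distance of the square from 1 controls the factor.\<close>
  then have "norm (1 - ?y) \<le> 2" using norm_triangle_ineq4[of 1 ?y] by simp
  then have "norm (1 - ?y) * norm (1 + ?y) \<le> 2 * norm (1 + ?y)"
    by (rule mult_right_mono) simp
  moreover have "?y\<^sup>2 = z\<^sup>2" by (simp add: power_mult_distrib flip: power_mult)
  then have "1 - z\<^sup>2 = (1 - ?y) * (1 + ?y)"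
    by (simp only: power2_eq_square) (simp add: algebra_simps)
  ultimately show ?thesis by (simp add: norm_mult)
qed

text \<open>Turns the additive loss M t into a factor exp (- C t) uniformly in x and y. For small t
  this follows from a logarithm estimate; for large t the bounds c <= y and x <= 2 suffice.\<close>

lemma exponential_lower_bound:
  fixes c M :: real
  assumes "c > 0" "M \<ge> 0"
  obtains C where "C \<ge> 0"
    "\<And>x y t. \<lbrakk>c \<le> x; x \<le> 2; c \<le> y; 0 \<le> t; x - M * t \<le> y\<rbrakk> \<Longrightarrow> x * exp (- C * t) \<le> y"
proof -
  \<comment> \<open>The summand 1 serves small t; the logarithm serves large t, where exp (- C t)
    has to fall to c / 2.\<close>
  define C where "C = 2 * M / c * (1 + \<bar>ln (2 / c)\<bar>)"
  have C: "2 * M / c \<le> C" "2 * M / c * \<bar>ln (2 / c)\<bar> \<le> C" "0 \<le> C"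
    using assms by (simp_all add: C_def algebra_simps)
  have "x * exp (- C * t) \<le> y"
    if xy: "c \<le> x" "x \<le> 2" "c \<le> y" "0 \<le> t" "x - M * t \<le> y" for x y t
  proof (cases "2 * M * t \<le> c")
    case True
    define s where "s = M * t / c"
    have s: "0 \<le> s" "s \<le> 1 / 2" using assms xy True by (simp_all add: s_def field_simps)
    have "- C * t \<le> - (2 * s)"
      using mult_right_mono[OF C(1) xy(4)] by (simp add: s_def)
    also have "\<dots> \<le> - s - 2 * s\<^sup>2"
      using s mult_left_mono[of s "1 / 2" s] by (simp add: power2_eq_square)
    also have "\<dots> \<le> ln (1 - s)" using s by (intro ln_one_minus_pos_lower_bound) auto
    finally have "exp (- C * t) \<le> 1 - s" using s by (subst (asm) ln_ge_iff) auto
    then have "x * exp (- C * t) \<le> x * (1 - s)" using xy assms by (intro mult_left_mono) auto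
    also have "\<dots> \<le> x - M * t"
      using mult_right_mono[OF xy(1) s(1)] assms by (simp add: s_def algebra_simps)
    finally show ?thesis using xy by simp
  next
    case False
    then have "1 \<le> 2 * M / c * t" using assms by (simp add: field_simps)
    then have "1 * \<bar>ln (2 / c)\<bar> \<le> (2 * M / c * t) * \<bar>ln (2 / c)\<bar>"
      by (rule mult_right_mono) simp
    also have "\<dots> \<le> C * t" using mult_right_mono[OF C(2) xy(4)] by (simp add: mult_ac)
    finally have "ln (2 / c) \<le> C * t" by simp
    then have "exp (- C * t) \<le> exp (- ln (2 / c))" by simp
    also have "\<dots> = c / 2" using assms by (simp add: exp_minus)
    finally have "x * exp (- C * t) \<le> 2 * (c / 2)" using xy assms by (intro mult_mono) auto
    then show ?thesis using xy by simp
  qed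
  then show thesis using C(3) that by blast
qed

lemma norm_prod_perturbed_root_ge:
  assumes "n \<ge> 1"
  obtains C where "C \<ge> 0" "\<And>K. cot (pi / (2 * (2 ^ n + 1))) ^ (2 ^ K) * exp (- C * real (n + K + 1)) \<le>
    norm (\<Prod>j<n * 2 ^ K. 1 + (-1) ^ perturbation_row n j * perturbed_root n ^ (2 ^ j))"
proof -
  let ?v = "\<lambda>j. base_root n ^ (2 ^ j)" and ?u = "\<lambda>j. perturbed_root n ^ (2 ^ j)"
  let ?f = "\<lambda>j z. norm (1 + (-1) ^ perturbation_row n j * z)"
  obtain c where c: "c > 0" "\<And>j. c \<le> norm (1 - ?u j)"
    using norm_one_minus_perturbed_root_power_ge[OF assms] by blast
  \<comment> \<open>Both orbits keep a distance from 1; the final division by 2 is the loss in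
    \<open>norm_one_minus_square_le\<close>.\<close>
  define b where "b = min c (norm (1 - base_root n) / 2 ^ n) / 2"
  have b: "b > 0" using c norm_base_root(1)[of n] by (simp add: b_def)
  have b_le: "b \<le> c / 2" "b \<le> norm (1 - base_root n) / 2 ^ n / 2" by (simp_all add: b_def)
  have half: "norm (1 - z ^ (2 ^ Suc j)) / 2 \<le> ?f j (z ^ (2 ^ j))" if "norm z = 1" for z :: complex and j
  proof -
    have "z ^ (2 ^ Suc j) = (z ^ (2 ^ j))\<^sup>2" by (simp add: mult.commute flip: power_mult)
    then show ?thesis using norm_one_minus_square_le[of "z ^ (2 ^ j)"] that by (simp add: norm_power)
  qed
  have ub: "b \<le> ?f j (?u j)" for j
    using half[of "perturbed_root n" j, OF norm_cis] c(2)[of "Suc j"] b_le(1) by linarith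
  have vb: "b \<le> ?f j (?v j)" for j
  proof -
    have "norm (1 - base_root n) / 2 ^ n / 2 \<le> norm (1 - base_root n ^ (2 ^ Suc j)) / 2"
      by (rule divide_right_mono) (rule norm_one_minus_base_root_power_ge[OF assms], simp)
    then show ?thesis using half[of "base_root n" j, OF norm_cis] b_le(2) by (meson order_trans)
  qed
  have v2: "?f j (?v j) \<le> 2" for j
    using norm_triangle_ineq[of 1 "(-1) ^ perturbation_row n j * ?v j"] by (simp add: norm_mult norm_power)
  have diff: "?f j (?v j) - 2 * pi * sparse_tail j \<le> ?f j (?u j)" for j
  proof -
    have "?f j (?v j) - ?f j (?u j) \<le> norm ((-1) ^ perturbation_row n j * (?v j - ?u j))"
      using norm_triangle_ineq2[of "1 + (-1) ^ perturbation_row n j * ?v j" "1 + (-1) ^ perturbation_row n j * ?u j"]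
      by (simp add: algebra_simps)
    also have "\<dots> \<le> 2 * pi * sparse_tail j"
      using norm_perturbed_root_diff[of n j] by (simp add: norm_mult norm_power)
    finally show ?thesis by simp
  qed
  obtain C where C: "C \<ge> 0"
    "\<And>x y t. \<lbrakk>b \<le> x; x \<le> 2; b \<le> y; 0 \<le> t; x - 2 * pi * t \<le> y\<rbrakk> \<Longrightarrow> x * exp (- C * t) \<le> y"
    using exponential_lower_bound[OF b, of "2 * pi"] pi_ge_zero by auto
  have "cot (pi / (2 * (2 ^ n + 1))) ^ (2 ^ K) * exp (- C * real (n + K + 1)) \<le>
      norm (\<Prod>j<n * 2 ^ K. 1 + (-1) ^ perturbation_row n j * ?u j)" for K
  proof -
    \<comment> \<open>Hence the positions up to n 2^K carry at most n + K ones, and the exponent of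
      the total loss is only linear in K.\<close>
    have "n * 2 ^ K \<le> 2 ^ (n + K)" using less_exp[of n] by (simp add: power_add)
    then have "(\<Sum>j<n * 2 ^ K. sparse_digit (Suc j)) \<le> (\<Sum>j<2 ^ (n + K). sparse_digit (Suc j))"
      by (intro sum_mono2) (auto simp: sparse_digit_bounds)
    also have "\<dots> \<le> real (n + K)" by (rule sum_sparse_digit_le)
    finally have "(\<Sum>j<n * 2 ^ K. sparse_tail j) \<le> real (n + K + 1)"
      using sum_sparse_tail[of "n * 2 ^ K"] by simp
    then have "exp (- C * real (n + K + 1)) \<le> exp (- C * (\<Sum>j<n * 2 ^ K. sparse_tail j))"
      using C(1) by (simp add: mult_left_mono)
    also have "\<dots> = (\<Prod>j<n * 2 ^ K. exp (- C * sparse_tail j))"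
      by (simp add: exp_sum sum_distrib_left)
    finally have "cot (pi / (2 * (2 ^ n + 1))) ^ (2 ^ K) * exp (- C * real (n + K + 1)) \<le>
        norm (\<Prod>j<n * 2 ^ K. 1 + (-1) ^ perturbation_row n j * ?v j) * (\<Prod>j<n * 2 ^ K. exp (- C * sparse_tail j))"
      unfolding norm_prod_base_root[OF assms, symmetric] by (rule mult_left_mono) simp
    also have "\<dots> = (\<Prod>j<n * 2 ^ K. ?f j (?v j) * exp (- C * sparse_tail j))"
      by (simp add: prod_norm prod.distrib)
    also have "\<dots> \<le> (\<Prod>j<n * 2 ^ K. ?f j (?u j))"
      by (intro prod_mono conjI C(2) vb v2 ub diff sparse_tail_bounds) simp
    finally show ?thesis by (simp add: prod_norm)
  qed
  then show thesis using C(1) that by blast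
qed

section \<open>Choice of N and conclusion\<close>

theorem theorem1p2:
  fixes n :: nat and \<alpha> \<beta> a \<epsilon> :: real
  assumes "n \<ge> 1"
    and "\<beta> = (\<Sum>k. 1 / 4 ^ (2 ^ k))"
    and "\<alpha> = 2 ^ n / (2 * (2 ^ n + 1)) + \<beta>"
    and "a = log (2 ^ n) (cot (pi / (2 * (2 ^ n + 1))))"
    and "\<epsilon> > 0"
  shows "infinitely_often_gg
           (\<lambda>N. real N * star_discrepancy (perturbed_halton_kronecker n \<alpha>) N)
           (\<lambda>N. real N powr (a - \<epsilon>))"
proof -
  define D where "D = (\<lambda>N. real N * star_discrepancy (perturbed_halton_kronecker n \<alpha>) N)"
  define \<kappa> where "\<kappa> = cot (pi / (2 * (2 ^ n + 1)))"
  have \<alpha>: "\<alpha> = base_angle n + sparse_tail 0"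
    by (simp add: assms base_angle_def sparse_tail_0)
  have "\<kappa> > 0"
    using norm_base_root[of n] by (metis \<kappa>_def zero_less_mult_pos2)
  obtain C where C: "C \<ge> 0" "\<And>K. \<kappa> ^ (2 ^ K) * exp (- C * real (n + K + 1)) \<le>
      norm (\<Prod>j<n * 2 ^ K. 1 + (-1) ^ perturbation_row n j * perturbed_root n ^ (2 ^ j))"
    using norm_prod_perturbed_root_ge[OF assms(1)] unfolding \<kappa>_def by blast
  \<comment> \<open>The loss exponent is linear in K, while ln N grows like 2^K for N = 2^(n 2^K),
    so N powr epsilon eventually absorbs the loss.\<close>
  have "(\<lambda>K. real (n + K + 1) / 2 ^ K) \<longlonglongrightarrow> 0"
    by real_asymp
  then have "(\<lambda>K. C * (real (n + K + 1) / 2 ^ K)) \<longlonglongrightarrow> 0"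
    by (rule tendsto_mult_right_zero)
  moreover have "0 < \<epsilon> * ln 2" using assms(5) by simp
  ultimately have "\<forall>\<^sub>F K in sequentially. C * (real (n + K + 1) / 2 ^ K) < \<epsilon> * ln 2"
    by (rule order_tendstoD)
  then have "\<forall>\<^sub>F K in sequentially. C * real (n + K + 1) \<le> \<epsilon> * ln 2 * 2 ^ K"
    by eventually_elim (simp add: pos_divide_less_eq)
  then obtain K0 where K0: "\<And>K. K \<ge> K0 \<Longrightarrow> C * real (n + K + 1) \<le> \<epsilon> * ln 2 * 2 ^ K"
    unfolding eventually_sequentially by blast
  let ?N = "\<lambda>K. 2 ^ (n * 2 ^ K) :: nat"
  have "1 / (3 * (1 + 2 * pi)) * \<bar>real (?N K) powr (a - \<epsilon>)\<bar> \<le> \<bar>D (?N K)\<bar>" if "K \<ge> K0" for K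
  proof -
    have "real (?N K) powr a = \<kappa> ^ (2 ^ K)"
    proof -
      have "real (?N K) = (2 ^ n) ^ (2 ^ K)" by (simp add: power_mult)
      also have "\<dots> = (2 ^ n) powr real (2 ^ K)" by (rule powr_realpow [symmetric]) simp
      also have "\<dots> powr a = ((2 ^ n) powr a) powr real (2 ^ K)"
        by (simp only: powr_powr mult.commute)
      also have "\<dots> = ((2 ^ n) powr a) ^ (2 ^ K)" by (rule powr_realpow) simp
      also have "(2 ^ n) powr a = \<kappa>"
        using \<open>\<kappa> > 0\<close> one_less_power[of "2 :: real" n] assms(1)
        unfolding assms(4) \<kappa>_def[symmetric] by (intro powr_log_cancel) linarith+
      finally show ?thesis .
    qed
    moreover have "real (?N K) powr - \<epsilon> \<le> exp (- C * real (n + K + 1))"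
    proof -
      have "C * real (n + K + 1) \<le> \<epsilon> * ln 2 * 2 ^ K" using K0[OF that] .
      \<comment> \<open>The new right-hand side is epsilon times ln N for N =
        \<open>?N K\<close>.\<close>
      also have "\<dots> \<le> \<epsilon> * ln 2 * (n * 2 ^ K)" using assms(1,5) by (intro mult_left_mono) auto
      finally show ?thesis by (simp add: powr_def ln_realpow mult_ac)
    qed
    ultimately have "real (?N K) powr (a - \<epsilon>) \<le> \<kappa> ^ (2 ^ K) * exp (- C * real (n + K + 1))"
      using \<open>\<kappa> > 0\<close> by (simp add: diff_conv_add_uminus powr_add del: add_uminus_conv_diff)
    also note C(2)
    also have "(\<Prod>j<n * 2 ^ K. 1 + (-1) ^ perturbation_row n j * perturbed_root n ^ (2 ^ j)) =
        (\<Sum>k<?N K. digit_sign (perturbation_row n) k * cis (2 * pi * \<alpha>) ^ k)"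
      by (simp add: sum_digit_sign_power \<alpha>)
    also have "norm \<dots> \<le> 3 * (1 + 2 * pi) * D (?N K)"
      unfolding D_def by (rule norm_sign_exponential_sum_le) simp
    finally have "real (?N K) powr (a - \<epsilon>) \<le> 3 * (1 + 2 * pi) * D (?N K)" .
    moreover have "3 * (1 + 2 * pi) > 0" by (simp add: add_pos_pos)
    ultimately have "1 / (3 * (1 + 2 * pi)) * real (?N K) powr (a - \<epsilon>) \<le> D (?N K)"
      by (simp add: pos_divide_le_eq mult.commute)
    then show ?thesis by simp
  qed
  then have "?N ` {K0..} \<subseteq> {N. \<bar>D N\<bar> \<ge> 1 / (3 * (1 + 2 * pi)) * \<bar>real N powr (a - \<epsilon>)\<bar>}"
    by auto
  moreover have "infinite (?N ` {K0..})"
  proof -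
    have "inj_on ?N {K0..}"
      using assms(1) by (intro inj_onI) simp
    then show ?thesis using infinite_Ici finite_imageD by blast
  qed
  ultimately have "infinite {N. \<bar>D N\<bar> \<ge> 1 / (3 * (1 + 2 * pi)) * \<bar>real N powr (a - \<epsilon>)\<bar>}"
    using infinite_super by blast
  moreover have "1 / (3 * (1 + 2 * pi)) > 0" by (simp add: add_pos_pos)
  ultimately show ?thesis unfolding infinitely_often_gg_def D_def by blast
qed

end
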